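(* For each pair $(\theta,\theta')\in\Theta\times\Theta$ with $\theta\neq\theta'$, $$p_{\mathsf{aux}}(\theta,\theta')\;\ge\;\bigl(1-d_{\mathsf{TV}}(\theta,\theta')\bigr)\,p_{\mathsf{MwG}}(\theta,\theta')\;\ge\; e^{-1/e}\exp\Bigl\{-\min\bigl\{d_{\mathsf{KL}}(\theta,\theta'),\ \tilde d_{\mathsf{KL}}(\theta,\theta'),\ \tilde d_{\mathsf{KL}}(\theta',\theta)\bigr\}\Bigr\}\,p_{\mathsf{MwG}}(\theta,\theta').$$
   Context: Setting. $\Theta$ is a measurable space with base measure $\lambda$; the target is a probability distribution on $\Theta$ with density $\pi(\theta\mid x)$ with respect to $\lambda$ ($x$ is fixed data). $\Omega_1,\Omega_2$ are measurable spaces with base measures $\lambda_1,\lambda_2$. For each $\theta$, $\mathbb{P}_\theta$ is a probability measure on $\Omega_1$ with density $\mathbb{P}_\theta(\omega_1)$ w.r.t. $\lambda_1$. For each $(\theta,\theta')$ and $\omega_1$, $\mathbb{P}_{\theta,\theta'}(\cdot\mid\omega_1)$ is a probability measure on $\Omega_2$ with density $\mathbb{P}_{\theta,\theta'}(\omega_2\mid\omega_1)$ w.r.t. $\lambda_2$. Put $\mathbb{P}_{\theta,\theta'}(\omega_1,\omega_2):=\mathbb{P}_\theta(\omega_1)\mathbb{P}_{\theta,\theta'}(\omega_2\mid\omega_1)$. For each $\omega_1$, $q_{\omega_1}(\theta,\cdot)$ is the density w.r.t. $\lambda$ of a Markov proposal kernel on $\Theta$. All densities are jointly measurable. Chain $\mathbb{P}_{\mathsf{aux}}$.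 From $\theta$: sample $\omega_1\sim\mathbb{P}_\theta$; propose $\theta'\sim q_{\omega_1}(\theta,\cdot)$; sample $\omega_2\sim\mathbb{P}_{\theta,\theta'}(\cdot\mid\omega_1)$; accept $\theta'$ with probability $\min\{1,r\}$, where $r=\frac{\pi(\theta'\mid x)\mathbb{P}_{\theta',\theta}(\omega_1,\omega_2)q_{\omega_1}(\theta',\theta)}{\pi(\theta\mid x)\mathbb{P}_{\theta,\theta'}(\omega_1,\omega_2)q_{\omega_1}(\theta,\theta')}$, else stay at $\theta$. Its density part (density of accepted moves) is $$p_{\mathsf{aux}}(\theta,\theta')=\int_{\Omega_1}\int_{\Omega_2}\mathbb{P}_\theta(\omega_1)q_{\omega_1}(\theta,\theta')\mathbb{P}_{\theta,\theta'}(\omega_2\mid\omega_1)\min\{1,r\}\,\lambda_2(d\omega_2)\lambda_1(d\omega_1).$$ Chain $\mathbb{P}_{\mathsf{MwG}}$ (the case $\omega_1=\omega_2$; a Metropolis-within-Gibbs chain). From $\theta$: sample $\omega_1\sim\mathbb{P}_\theta$; propose $\theta'\sim q_{\omega_1}(\theta,\cdot)$; accept with probability $\min\{1,r_1\}$, $r_1=\frac{\pi(\theta'\mid x)\mathbb{P}_{\theta'}(\omega_1)q_{\omega_1}(\theta',\theta)}{\pi(\theta\mid x)\mathbb{P}_\theta(\omega_1)q_{\omega_1}(\theta,\theta')}$, else stay. Its density part is $p_{\mathsf{MwG}}(\theta,\theta')=\int_{\Omega_1}\mathbb{P}_\theta(\omega_1)q_{\omega_1}(\theta,\theta')\min\{1,r_1\}\lambda_1(d\omega_1)$.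 Convention: whenever the denominator of an acceptance ratio is $0$, the acceptance probability is taken to be $1$. Distances. With $d_{\mathsf{TV}}(P,Q)=\sup_A|P(A)-Q(A)|$ and $d_{\mathsf{KL}}(P\Vert Q)$ the Kullback–Leibler divergence (values in $[0,\infty]$, with $e^{-\infty}=0$): $d_{\mathsf{TV}}(\theta,\theta'):=\sup_{\omega_1}d_{\mathsf{TV}}\bigl(\mathbb{P}_{\theta,\theta'}(\cdot\mid\omega_1),\mathbb{P}_{\theta',\theta}(\cdot\mid\omega_1)\bigr)$; $\tilde d_{\mathsf{KL}}(\theta,\theta'):=\sup_{\omega_1}d_{\mathsf{KL}}\bigl(\mathbb{P}_{\theta,\theta'}(\cdot\mid\omega_1)\Vert\mathbb{P}_{\theta',\theta}(\cdot\mid\omega_1)\bigr)$; $d_{\mathsf{KL}}(\theta,\theta'):=\tfrac12\sup_{\omega_1}\Bigl(d_{\mathsf{KL}}\bigl(\mathbb{P}_{\theta,\theta'}(\cdot\mid\omega_1)\Vert\mathbb{P}_{\theta',\theta}(\cdot\mid\omega_1)\bigr)+d_{\mathsf{KL}}\bigl(\mathbb{P}_{\theta',\theta}(\cdot\mid\omega_1)\Vert\mathbb{P}_{\theta,\theta'}(\cdot\mid\omega_1)\bigr)\Bigr)$. Suprema are over $\omega_1\in\Omega_1$. *)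

theory Defs
  imports "HOL-Probability.Probability"
begin

definition tv_dist :: "'a measure \<Rightarrow> 'a measure \<Rightarrow> real" where
  "tv_dist P Q = (SUP A\<in>sets P. \<bar>measure P A - measure Q A\<bar>)"

text \<open>
  Kullback--Leibler divergence of \<open>P\<close> from \<open>Q\<close> with values in \<open>[0, \<infinity>]\<close>. The library constant
  \<^const>\<open>KL_divergence\<close> takes the reference measure \<open>Q\<close> first, is real-valued, and is \<open>0\<close> where
  the log-density is not integrable. For probability measures \<open>P \<lless> Q\<close> the negative part of
  \<open>ln (dP/dQ)\<close> is always \<open>P\<close>-integrable, so non-integrability means that the divergence is \<open>\<infinity>\<close>.
\<close>

definition kl_div :: "'a measure \<Rightarrow> 'a measure \<Rightarrow> ereal" where
  "kl_div P Q =
    (if absolutely_continuous Q P \<and> integrable P (entropy_density (exp 1) Q P)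
     then ereal (KL_divergence (exp 1) Q P) else \<infinity>)"

definition exp_neg :: "ereal \<Rightarrow> ennreal" where
  "exp_neg t = (case t of ereal r \<Rightarrow> ennreal (exp (- r)) | PInfty \<Rightarrow> 0 | MInfty \<Rightarrow> \<infinity>)"


text \<open>
  Base measures \<open>\<mu>\<close>, \<open>\<mu>1\<close>, \<open>\<mu>2\<close> on \<open>\<Theta>\<close>, \<open>\<Omega>\<^sub>1\<close>, \<open>\<Omega>\<^sub>2\<close>, and densities: \<open>post \<theta>\<close> of the target (the fixed
  data \<open>x\<close> is suppressed), \<open>f1 \<theta> \<omega>1\<close> of \<open>P\<^sub>\<theta>\<close>, \<open>f2 \<theta> \<theta>' \<omega>1 \<omega>2\<close> of \<open>P\<^bsub>\<theta>,\<theta>'\<^esub>(\<cdot> | \<omega>1)\<close>, and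
  \<open>q \<omega>1 \<theta> \<theta>'\<close> of the proposal kernel at \<open>\<theta>\<close>.
\<close>

locale aux_mcmc =
  fixes \<mu> :: "'t measure" and \<mu>1 :: "'a measure" and \<mu>2 :: "'b measure"
    and post :: "'t \<Rightarrow> real"
    and f1 :: "'t \<Rightarrow> 'a \<Rightarrow> real"
    and f2 :: "'t \<Rightarrow> 't \<Rightarrow> 'a \<Rightarrow> 'b \<Rightarrow> real"
    and q :: "'a \<Rightarrow> 't \<Rightarrow> 't \<Rightarrow> real"
  assumes post_measurable: "post \<in> borel_measurable \<mu>"
    and f1_measurable: "(\<lambda>(\<theta>, \<omega>1). f1 \<theta> \<omega>1) \<in> borel_measurable (\<mu> \<Otimes>\<^sub>M \<mu>1)"
    and f2_measurable:
      "(\<lambda>(\<theta>, \<theta>', \<omega>1, \<omega>2). f2 \<theta> \<theta>' \<omega>1 \<omega>2) \<in> borel_measurable (\<mu> \<Otimes>\<^sub>M \<mu> \<Otimes>\<^sub>M \<mu>1 \<Otimes>\<^sub>M \<mu>2)"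
    and q_measurable: "(\<lambda>(\<omega>1, \<theta>, \<theta>'). q \<omega>1 \<theta> \<theta>') \<in> borel_measurable (\<mu>1 \<Otimes>\<^sub>M \<mu> \<Otimes>\<^sub>M \<mu>)"
    and post_nonneg: "\<And>\<theta>. \<theta> \<in> space \<mu> \<Longrightarrow> 0 \<le> post \<theta>"
    and f1_nonneg: "\<And>\<theta> \<omega>1. \<theta> \<in> space \<mu> \<Longrightarrow> \<omega>1 \<in> space \<mu>1 \<Longrightarrow> 0 \<le> f1 \<theta> \<omega>1"
    and f2_nonneg: "\<And>\<theta> \<theta>' \<omega>1 \<omega>2. \<theta> \<in> space \<mu> \<Longrightarrow> \<theta>' \<in> space \<mu> \<Longrightarrow> \<omega>1 \<in> space \<mu>1 \<Longrightarrow>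
      \<omega>2 \<in> space \<mu>2 \<Longrightarrow> 0 \<le> f2 \<theta> \<theta>' \<omega>1 \<omega>2"
    and q_nonneg: "\<And>\<omega>1 \<theta> \<theta>'. \<omega>1 \<in> space \<mu>1 \<Longrightarrow> \<theta> \<in> space \<mu> \<Longrightarrow> \<theta>' \<in> space \<mu> \<Longrightarrow> 0 \<le> q \<omega>1 \<theta> \<theta>'"
    and post_prob: "prob_space (density \<mu> (\<lambda>\<theta>. ennreal (post \<theta>)))"
    and f1_prob: "\<And>\<theta>. \<theta> \<in> space \<mu> \<Longrightarrow> prob_space (density \<mu>1 (\<lambda>\<omega>1. ennreal (f1 \<theta> \<omega>1)))"
    and f2_prob: "\<And>\<theta> \<theta>' \<omega>1. \<theta> \<in> space \<mu> \<Longrightarrow> \<theta>' \<in> space \<mu> \<Longrightarrow> \<omega>1 \<in> space \<mu>1 \<Longrightarrow>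
      prob_space (density \<mu>2 (\<lambda>\<omega>2. ennreal (f2 \<theta> \<theta>' \<omega>1 \<omega>2)))"
    and q_prob: "\<And>\<omega>1 \<theta>. \<omega>1 \<in> space \<mu>1 \<Longrightarrow> \<theta> \<in> space \<mu> \<Longrightarrow>
      prob_space (density \<mu> (\<lambda>\<theta>'. ennreal (q \<omega>1 \<theta> \<theta>')))"

definition accept_prob :: "real \<Rightarrow> real \<Rightarrow> real" where
  "accept_prob num den = (if den = 0 then 1 else min 1 (num / den))"

definition joint_dens ::
  "('t \<Rightarrow> 'a \<Rightarrow> real) \<Rightarrow> ('t \<Rightarrow> 't \<Rightarrow> 'a \<Rightarrow> 'b \<Rightarrow> real) \<Rightarrow> 't \<Rightarrow> 't \<Rightarrow> 'a \<Rightarrow> 'b \<Rightarrow> real" where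
  "joint_dens f1 f2 \<theta> \<theta>' \<omega>1 \<omega>2 = f1 \<theta> \<omega>1 * f2 \<theta> \<theta>' \<omega>1 \<omega>2"

text \<open>
  At a fixed pair \<open>(\<theta>, \<theta>')\<close> the densities of accepted moves can be infinite, because
  \<open>q \<omega>1 \<theta> \<theta>'\<close> need not be integrable in \<open>\<omega>1\<close>; hence values in \<open>[0, \<infinity>]\<close>.
\<close>

definition p_aux ::
  "'a measure \<Rightarrow> 'b measure \<Rightarrow> ('t \<Rightarrow> real) \<Rightarrow> ('t \<Rightarrow> 'a \<Rightarrow> real) \<Rightarrow>
   ('t \<Rightarrow> 't \<Rightarrow> 'a \<Rightarrow> 'b \<Rightarrow> real) \<Rightarrow> ('a \<Rightarrow> 't \<Rightarrow> 't \<Rightarrow> real) \<Rightarrow> 't \<Rightarrow> 't \<Rightarrow> ennreal" where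
  "p_aux \<mu>1 \<mu>2 post f1 f2 q \<theta> \<theta>' =
    (\<integral>\<^sup>+\<omega>1. (\<integral>\<^sup>+\<omega>2. ennreal (f1 \<theta> \<omega>1 * q \<omega>1 \<theta> \<theta>' * f2 \<theta> \<theta>' \<omega>1 \<omega>2 *
        accept_prob
          (post \<theta>' * joint_dens f1 f2 \<theta>' \<theta> \<omega>1 \<omega>2 * q \<omega>1 \<theta>' \<theta>)
          (post \<theta> * joint_dens f1 f2 \<theta> \<theta>' \<omega>1 \<omega>2 * q \<omega>1 \<theta> \<theta>')) \<partial>\<mu>2) \<partial>\<mu>1)"

definition p_MwG ::
  "'a measure \<Rightarrow> ('t \<Rightarrow> real) \<Rightarrow> ('t \<Rightarrow> 'a \<Rightarrow> real) \<Rightarrow> ('a \<Rightarrow> 't \<Rightarrow> 't \<Rightarrow> real) \<Rightarrow>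
   't \<Rightarrow> 't \<Rightarrow> ennreal" where
  "p_MwG \<mu>1 post f1 q \<theta> \<theta>' =
    (\<integral>\<^sup>+\<omega>1. ennreal (f1 \<theta> \<omega>1 * q \<omega>1 \<theta> \<theta>' *
        accept_prob
          (post \<theta>' * f1 \<theta>' \<omega>1 * q \<omega>1 \<theta>' \<theta>)
          (post \<theta> * f1 \<theta> \<omega>1 * q \<omega>1 \<theta> \<theta>')) \<partial>\<mu>1)"

definition cond_law ::
  "'b measure \<Rightarrow> ('t \<Rightarrow> 't \<Rightarrow> 'a \<Rightarrow> 'b \<Rightarrow> real) \<Rightarrow> 't \<Rightarrow> 't \<Rightarrow> 'a \<Rightarrow> 'b measure" where
  "cond_law \<mu>2 f2 \<theta> \<theta>' \<omega>1 = density \<mu>2 (\<lambda>\<omega>2. ennreal (f2 \<theta> \<theta>' \<omega>1 \<omega>2))"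

definition d_TV ::
  "'a measure \<Rightarrow> 'b measure \<Rightarrow> ('t \<Rightarrow> 't \<Rightarrow> 'a \<Rightarrow> 'b \<Rightarrow> real) \<Rightarrow> 't \<Rightarrow> 't \<Rightarrow> real" where
  "d_TV \<mu>1 \<mu>2 f2 \<theta> \<theta>' =
    (SUP \<omega>1\<in>space \<mu>1. tv_dist (cond_law \<mu>2 f2 \<theta> \<theta>' \<omega>1) (cond_law \<mu>2 f2 \<theta>' \<theta> \<omega>1))"

definition d_KL_tilde ::
  "'a measure \<Rightarrow> 'b measure \<Rightarrow> ('t \<Rightarrow> 't \<Rightarrow> 'a \<Rightarrow> 'b \<Rightarrow> real) \<Rightarrow> 't \<Rightarrow> 't \<Rightarrow> ereal" where
  "d_KL_tilde \<mu>1 \<mu>2 f2 \<theta> \<theta>' =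
    (SUP \<omega>1\<in>space \<mu>1. kl_div (cond_law \<mu>2 f2 \<theta> \<theta>' \<omega>1) (cond_law \<mu>2 f2 \<theta>' \<theta> \<omega>1))"

definition d_KL ::
  "'a measure \<Rightarrow> 'b measure \<Rightarrow> ('t \<Rightarrow> 't \<Rightarrow> 'a \<Rightarrow> 'b \<Rightarrow> real) \<Rightarrow> 't \<Rightarrow> 't \<Rightarrow> ereal" where
  "d_KL \<mu>1 \<mu>2 f2 \<theta> \<theta>' =
    ereal (1 / 2) * (SUP \<omega>1\<in>space \<mu>1.
      kl_div (cond_law \<mu>2 f2 \<theta> \<theta>' \<omega>1) (cond_law \<mu>2 f2 \<theta>' \<theta> \<omega>1) +
      kl_div (cond_law \<mu>2 f2 \<theta>' \<theta> \<omega>1) (cond_law \<mu>2 f2 \<theta> \<theta>' \<omega>1))"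

end

theory Submission
  imports Defs
begin

text \<open>
  Pointwise in \<open>\<omega>1\<close>, with \<open>f\<close>, \<open>g\<close> the two conditional densities and \<open>a\<close>, \<open>b\<close> the denominator and
  numerator of \<open>r\<^sub>1\<close>, one has \<open>f min(1, b g / (a f)) \<ge> min(1, b / a) min(f, g)\<close>, and
  \<open>\<integral> min(f, g) = 1 - d\<^sub>T\<^sub>V\<close>. For the second bound, if \<open>D = dP/dQ\<close> then
  \<open>1 - d\<^sub>T\<^sub>V = E\<^sub>P[exp(- max(0, ln D))] \<ge> exp(- E\<^sub>P[max(0, ln D)])\<close> by Jensen's inequality, and
  \<open>E\<^sub>P[max(0, ln D)] = KL(P, Q) + E\<^sub>Q[D max(0, - ln D)] \<le> KL(P, Q) + 1/e\<close> because
  \<open>- D ln D \<le> 1/e\<close>.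
\<close>

section \<open>Scalar facts about \<open>exp_neg\<close> and - x ln x\<close>

lemma exp_neg_antimono:
  assumes "s \<le> t"
  shows "exp_neg t \<le> exp_neg s"
  using assms by (cases s; cases t) (auto simp: exp_neg_def intro!: ennreal_leI)

text \<open>The tangent bound ln y \<le> y - 1, taken at y = 1 / (e x), gives - ln x \<le> 1 / (e
  x), with equality at x = 1/e. This is the source of the factor \<open>exp (- (1 / exp 1))\<close>
  in the theorem.\<close>

lemma neg_mult_ln_le:
  fixes x :: real
  assumes "0 \<le> x"
  shows "x * max 0 (- ln x) \<le> 1 / exp 1"
proof (cases "x = 0")
  case False
  with assms have x: "0 < x" by simp
  have "ln (1 / (x * exp 1)) \<le> 1 / (x * exp 1) - 1"
    using x by (intro ln_le_minus_one) simp
  then have "- ln x \<le> 1 / (x * exp 1)"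
    using x by (simp add: ln_div ln_mult)
  then have "x * - ln x \<le> x * (1 / (x * exp 1))"
    using x by (intro mult_left_mono) auto
  then show ?thesis
    using x by (auto simp: max_def)
qed simp

section \<open>Total variation distance and the overlap of densities\<close>

lemma tv_dist_upper:
  assumes "prob_space P" "prob_space Q" "A \<in> sets P"
  shows "\<bar>measure P A - measure Q A\<bar> \<le> tv_dist P Q"
proof -
  \<comment> \<open>\<open>tv_dist\<close> is a supremum of reals, so it dominates its members only
    once the family is known to be bounded.\<close>
  have "\<bar>measure P B - measure Q B\<bar> \<le> 1" for B
    using prob_space.prob_le_1[OF assms(1), of B] prob_space.prob_le_1[OF assms(2), of B]
      measure_nonneg[of P B] measure_nonneg[of Q B] by linarith
  then show ?thesis
    unfolding tv_dist_def using assms(3) by (intro cSUP_upper bdd_aboveI2) auto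
qed

lemma tv_dist_least:
  assumes "\<And>A. A \<in> sets P \<Longrightarrow> \<bar>measure P A - measure Q A\<bar> \<le> c"
  shows "tv_dist P Q \<le> c"
  unfolding tv_dist_def using assms by (intro cSUP_least) auto

lemma tv_dist_le_1:
  assumes "prob_space P" "prob_space Q"
  shows "tv_dist P Q \<le> 1"
proof (rule tv_dist_least)
  fix A
  show "\<bar>measure P A - measure Q A\<bar> \<le> 1"
    using prob_space.prob_le_1[OF assms(1), of A] prob_space.prob_le_1[OF assms(2), of A]
      measure_nonneg[of P A] measure_nonneg[of Q A] by linarith
qed

lemma tv_dist_commute:
  assumes "sets P = sets Q"
  shows "tv_dist P Q = tv_dist Q P"
  unfolding tv_dist_def assms by (simp add: abs_minus_commute)

text \<open>The set \<open>A\<close> where \<open>g < f\<close> is the extremal one: there min(f, g)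
  is \<open>g\<close>, elsewhere it is \<open>f\<close>, so the overlap integral equals Q(A) +
  P(A^c) = 1 - (P(A) - Q(A)).\<close>

lemma one_minus_tv_dist_le_overlap:
  fixes f g :: "'a \<Rightarrow> real"
  assumes [measurable]: "f \<in> borel_measurable M" "g \<in> borel_measurable M"
    and P: "prob_space (density M (\<lambda>x. ennreal (f x)))"
    and Q: "prob_space (density M (\<lambda>x. ennreal (g x)))"
  shows "ennreal (1 - tv_dist (density M (\<lambda>x. ennreal (f x))) (density M (\<lambda>x. ennreal (g x))))
    \<le> (\<integral>\<^sup>+x. ennreal (min (f x) (g x)) \<partial>M)"
proof -
  let ?P = "density M (\<lambda>x. ennreal (f x))" and ?Q = "density M (\<lambda>x. ennreal (g x))"
  interpret P: prob_space ?P by (rule P)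
  interpret Q: prob_space ?Q by (rule Q)
  define A where "A = {x \<in> space M. g x < f x}"
  have A [measurable]: "A \<in> sets M" unfolding A_def by measurable
  have "measure ?P A - measure ?Q A \<le> tv_dist ?P ?Q"
    using tv_dist_upper[OF P Q, of A] by simp
  then have "1 - tv_dist ?P ?Q \<le> measure ?Q A + measure ?P (space M - A)"
    using P.prob_compl[of A] by simp
  then have "ennreal (1 - tv_dist ?P ?Q) \<le> emeasure ?Q A + emeasure ?P (space M - A)"
    by (simp add: Q.emeasure_eq_measure P.emeasure_eq_measure ennreal_leI flip: ennreal_plus)
  also have "\<dots> = (\<integral>\<^sup>+x. ennreal (g x) * indicator A x + ennreal (f x) * indicator (space M - A) x \<partial>M)"
    by (simp add: emeasure_density nn_integral_add)
  also have "\<dots> = (\<integral>\<^sup>+x. ennreal (min (f x) (g x)) \<partial>M)"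
    by (intro nn_integral_cong) (auto simp: A_def indicator_def)
  finally show ?thesis .
qed

section \<open>Total variation bounded through Kullback-Leibler divergence\<close>

lemma tv_dist_le_one_minus_exp_KL:
  assumes P: "prob_space P" and Q: "prob_space Q" and sets: "sets P = sets Q"
    and ac: "absolutely_continuous Q P"
    and int: "integrable P (entropy_density (exp 1) Q P)"
  shows "tv_dist P Q \<le> 1 - exp (- (1 / exp 1)) * exp (- KL_divergence (exp 1) Q P)"
proof -
  interpret P: prob_space P by (rule P)
  interpret Q: prob_space Q by (rule Q)
  \<comment> \<open>\<open>D\<close> is a finite, nonnegative version of dP/dQ, so integrals against
    \<open>P\<close> become real integrals against \<open>Q\<close> with weight
    \<open>D\<close>.\<close>
  obtain D where [measurable]: "D \<in> borel_measurable Q"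
    and RN: "AE x in Q. RN_deriv Q P x = ennreal (D x)"
    and "AE x in P. 0 < D x" and D_nonneg: "\<And>x. 0 \<le> D x"
    using Q.real_RN_deriv[OF _ ac] sets P.finite_measure_axioms by blast
  have "P = density Q (RN_deriv Q P)"
    using Q.density_RN_deriv[OF ac sets] by simp
  also have "\<dots> = density Q (\<lambda>x. ennreal (D x))"
    using RN by (intro density_cong) auto
  finally have P_eq: "P = density Q (\<lambda>x. ennreal (D x))" .
  have RN_P: "AE x in P. RN_deriv Q P x = ennreal (D x)"
    using absolutely_continuous_AE[OF sets ac RN] .
  have meas_P: "h \<in> borel_measurable P \<longleftrightarrow> h \<in> borel_measurable Q" for h :: "'a \<Rightarrow> real"
    using measurable_cong_sets[OF sets refl] by auto
  have ent: "AE x in P. entropy_density (exp 1) Q P x = ln (D x)"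
    using RN_P by eventually_elim (simp add: entropy_density_def log_def D_nonneg)
  have int_ln: "integrable P (\<lambda>x. ln (D x))"
    using int ent by (subst integrable_cong_AE[symmetric]) (auto simp: meas_P intro: borel_measurable_integrable)
  have KL: "KL_divergence (exp 1) Q P = (\<integral>x. ln (D x) \<partial>P)"
    unfolding KL_divergence_def using ent int
    by (intro integral_cong_AE) (auto simp: meas_P borel_measurable_integrable)
  \<comment> \<open>Where \<open>D x > 0\<close>, \<open>exp (X x)\<close> is min(1, 1 / D x), so
    its \<open>P\<close>-mean is the overlap of \<open>P\<close> and \<open>Q\<close>, while the
    mean of \<open>X\<close> itself is within 1/e of the negated divergence.\<close>
  define X where "X x = min 0 (- ln (D x))" for x
  have [measurable]: "X \<in> borel_measurable Q"
    unfolding X_def by measurable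
  define m where "m = (\<integral>x. X x \<partial>P)"
  have int_max: "integrable P (\<lambda>x. max 0 (- ln (D x)))"
    using int_ln by auto
  have X_eq: "X x = - ln (D x) - max 0 (- ln (D x))" for x
    by (auto simp: X_def)
  have int_X: "integrable P X"
    unfolding X_eq[abs_def] using int_ln int_max by auto
  \<comment> \<open>Under \<open>Q\<close> the integrand gains the weight \<open>D\<close> and is at
    most 1/e pointwise; since \<open>Q\<close> has mass 1, the bound survives integration.\<close>
  have "(\<integral>x. max 0 (- ln (D x)) \<partial>P) = (\<integral>x. D x * max 0 (- ln (D x)) \<partial>Q)"
    unfolding P_eq by (subst integral_density) (auto simp: D_nonneg)
  also have "\<dots> \<le> (\<integral>x. 1 / exp 1 \<partial>Q)"
    by (intro integral_mono') (auto simp: D_nonneg neg_mult_ln_le)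
  also have "\<dots> = 1 / exp 1"
    by (simp add: Q.prob_space)
  finally have max_le: "(\<integral>x. max 0 (- ln (D x)) \<partial>P) \<le> 1 / exp 1" .
  have "m = - KL_divergence (exp 1) Q P - (\<integral>x. max 0 (- ln (D x)) \<partial>P)"
    unfolding m_def X_eq KL using int_ln int_max by simp
  with max_le have m_ge: "- (1 / exp 1) - KL_divergence (exp 1) Q P \<le> m"
    by simp
  \<comment> \<open>The weight \<open>D\<close> clears the denominator in \<open>exp (X x)\<close>;
    at \<open>D x = 0\<close> both sides vanish whatever \<open>X x\<close> is.\<close>
  have D_exp: "D x * exp (X x) = min 1 (D x)" for x
  proof (cases "D x = 0")
    case False
    with D_nonneg[of x] have "0 < D x" by simp
    then show ?thesis
      by (auto simp: X_def min_def exp_minus field_simps)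
  qed simp
  \<comment> \<open>The \<open>Q\<close>-integral of \<open>D\<close> is the total mass of
    \<open>P\<close>. Hence \<open>min 1 (D x)\<close> is \<open>Q\<close>-integrable, and by
    \<open>D_exp\<close> so is \<open>exp (X x)\<close> under \<open>P\<close>.\<close>
  have int_D: "integrable Q D"
    using P.emeasure_space_1 unfolding P_eq
    by (intro integrableI_nonneg) (auto simp: D_nonneg emeasure_density)
  have int_min: "integrable Q (\<lambda>x. min 1 (D x))"
    using int_D by auto
  have int_exp: "integrable P (\<lambda>x. exp (X x))"
    unfolding P_eq by (subst integrable_density) (auto simp: D_nonneg D_exp int_min)
  \<comment> \<open>Jensen's inequality for \<open>exp\<close>, through the tangent at the mean \<open>m\<close>.\<close>
  have "exp m = (\<integral>x. exp m * (1 + (X x - m)) \<partial>P)"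
    using int_X by (simp add: m_def P.prob_space)
  also have "\<dots> \<le> (\<integral>x. exp (X x) \<partial>P)"
  proof (intro integral_mono)
    show "exp m * (1 + (X x - m)) \<le> exp (X x)" for x
      using mult_left_mono[OF exp_ge_add_one_self[of "X x - m"], of "exp m"]
      by (simp flip: exp_add)
  qed (use int_X int_exp in auto)
  also have "\<dots> = (\<integral>x. min 1 (D x) \<partial>Q)"
    unfolding P_eq by (subst integral_density) (auto simp: D_nonneg D_exp)
  finally have exp_m: "exp m \<le> (\<integral>x. min 1 (D x) \<partial>Q)" .
  \<comment> \<open>Any measurable split bounds the overlap from above: min(1, D) \<le> D off
    \<open>A\<close> and min(1, D) \<le> 1 on \<open>A\<close>.\<close>
  have overlap: "(\<integral>x. min 1 (D x) \<partial>Q) \<le> measure P (space Q - A) + measure Q A" if A: "A \<in> sets Q" for A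
  proof -
    note A [measurable]
    have int_A: "integrable Q (\<lambda>x. D x * indicator (space Q - A) x)"
      "integrable Q (indicator A :: _ \<Rightarrow> real)"
      using int_D by (intro integrable_real_mult_indicator; simp)
        (simp add: integrable_indicator_iff Q.emeasure_eq_measure)
    have "(\<integral>x. min 1 (D x) \<partial>Q) \<le> (\<integral>x. D x * indicator (space Q - A) x + indicator A x \<partial>Q)"
      by (intro integral_mono int_min Bochner_Integration.integrable_add int_A)
        (auto simp: indicator_def)
    also have "\<dots> = (\<integral>x. D x * indicator (space Q - A) x \<partial>Q) + measure Q A"
      using int_A by simp
    also have "(\<integral>x. D x * indicator (space Q - A) x \<partial>Q) = (\<integral>x. indicator (space Q - A) x \<partial>P)"
      unfolding P_eq by (subst integral_density) (auto simp: D_nonneg)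
    also have "\<dots> = measure P (space Q - A)"
      using sets.sets_into_space[OF A] sets_eq_imp_space_eq[OF sets] by (simp add: Int_absorb2)
    finally show ?thesis by simp
  qed
  \<comment> \<open>\<open>overlap\<close> at \<open>A\<close> bounds P(A) - Q(A), and at the
    complement of \<open>A\<close> it bounds Q(A) - P(A); together they control the absolute
    value.\<close>
  have "\<bar>measure P A - measure Q A\<bar> \<le> 1 - exp m" if A: "A \<in> sets P" for A
  proof -
    have sp: "space P = space Q"
      by (rule sets_eq_imp_space_eq[OF sets])
    have "space Q - (space Q - A) = A"
      using sets.sets_into_space[OF A] sp by auto
    then show ?thesis
      using overlap[of A] overlap[of "space Q - A"] exp_m P.prob_compl[OF A] Q.prob_compl[of A] A
      unfolding sp sets by auto
  qed
  then have "tv_dist P Q \<le> 1 - exp m"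
    by (rule tv_dist_least)
  also have "\<dots> \<le> 1 - exp (- (1 / exp 1) - KL_divergence (exp 1) Q P)"
    using m_ge by simp
  also have "\<dots> = 1 - exp (- (1 / exp 1)) * exp (- KL_divergence (exp 1) Q P)"
    by (simp flip: exp_add)
  finally show ?thesis .
qed

text \<open>Prepares the previous bound for suprema: \<open>exp_neg\<close> is antitone, so any
  upper bound \<open>t\<close> of the divergence will do. If \<open>kl_div P Q\<close> is infinite,
  its \<open>exp_neg\<close> is 0 and the bound is trivial.\<close>

lemma exp_neg_kl_div_le_one_minus_tv_dist:
  assumes "prob_space P" "prob_space Q" "sets P = sets Q" "kl_div P Q \<le> t"
  shows "ennreal (exp (- (1 / exp 1))) * exp_neg t \<le> ennreal (1 - tv_dist P Q)"
proof -
  have "ennreal (exp (- (1 / exp 1))) * exp_neg t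
      \<le> ennreal (exp (- (1 / exp 1))) * exp_neg (kl_div P Q)"
    by (intro mult_left_mono exp_neg_antimono assms) simp
  also have "\<dots> \<le> ennreal (1 - tv_dist P Q)"
    using tv_dist_le_one_minus_exp_KL[OF assms(1-3)]
    by (auto simp: kl_div_def exp_neg_def simp flip: ennreal_mult intro!: ennreal_leI)
  finally show ?thesis .
qed

section \<open>Scalar inequalities for averaged divergences and acceptance probabilities\<close>

lemma ereal_half_mult_add_ge_min:
  fixes a b :: ereal
  shows "min a b \<le> ereal (1 / 2) * (a + b)"
  by (cases a; cases b) (auto simp: min_def field_simps)

text \<open>For positive \<open>a\<close> and \<open>u\<close> the right side is the minimum of
  \<open>u\<close> and \<open>v * (b / a)\<close>, and each of these dominates the left side. For
  \<open>a = 0\<close> both acceptance probabilities are 1 by convention; for \<open>u = 0\<close>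
  both sides vanish.\<close>

lemma accept_prob_scale_ge:
  assumes "0 \<le> a" "0 \<le> b" "0 \<le> u" "0 \<le> v"
  shows "min u v * accept_prob b a \<le> u * accept_prob (b * v) (a * u)"
proof -
  consider "a = 0" | "0 < a" "u = 0" | "0 < a" "0 < u"
    using assms by fastforce
  then show ?thesis
  proof cases
    case 1
    then show ?thesis by (simp add: accept_prob_def)
  next
    case 2
    with assms show ?thesis by (simp add: accept_prob_def)
  next
    case 3
    have "min u v * min 1 (b / a) \<le> u * 1"
      using assms 3 by (intro mult_mono) auto
    moreover have "min u v * min 1 (b / a) \<le> v * (b / a)"
      using assms 3 by (intro mult_mono) auto
    ultimately show ?thesis
      using 3 by (simp add: accept_prob_def min_mult_distrib_left field_simps)
  qed
qed

section \<open>Comparison of the accepted-move densities of the two chains\<close>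

context aux_mcmc
begin

lemma f1_measurable1 [measurable]: "\<theta> \<in> space \<mu> \<Longrightarrow> f1 \<theta> \<in> borel_measurable \<mu>1"
  using measurable_compose[OF measurable_Pair1' f1_measurable, of \<theta>] by simp

lemma f2_measurable2 [measurable]:
  assumes "\<theta> \<in> space \<mu>" "\<theta>' \<in> space \<mu>" "\<omega>1 \<in> space \<mu>1"
  shows "f2 \<theta> \<theta>' \<omega>1 \<in> borel_measurable \<mu>2"
proof -
  have "(\<lambda>\<omega>2. (\<theta>, \<theta>', \<omega>1, \<omega>2)) \<in> \<mu>2 \<rightarrow>\<^sub>M \<mu> \<Otimes>\<^sub>M \<mu> \<Otimes>\<^sub>M \<mu>1 \<Otimes>\<^sub>M \<mu>2"
    using assms by measurable
  from measurable_compose[OF this f2_measurable] show ?thesis by simp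
qed

lemma q_measurable1 [measurable]:
  assumes "\<theta> \<in> space \<mu>" "\<theta>' \<in> space \<mu>"
  shows "(\<lambda>\<omega>1. q \<omega>1 \<theta> \<theta>') \<in> borel_measurable \<mu>1"
proof -
  have "(\<lambda>\<omega>1. (\<omega>1, \<theta>, \<theta>')) \<in> \<mu>1 \<rightarrow>\<^sub>M \<mu>1 \<Otimes>\<^sub>M \<mu> \<Otimes>\<^sub>M \<mu>"
    using assms by measurable
  from measurable_compose[OF this q_measurable] show ?thesis by simp
qed

lemma prob_space_cond_law:
  assumes "\<theta> \<in> space \<mu>" "\<theta>' \<in> space \<mu>" "\<omega>1 \<in> space \<mu>1"
  shows "prob_space (cond_law \<mu>2 f2 \<theta> \<theta>' \<omega>1)"
  unfolding cond_law_def using assms by (rule f2_prob)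

lemma sets_cond_law [simp]: "sets (cond_law \<mu>2 f2 \<theta> \<theta>' \<omega>1) = sets \<mu>2"
  by (simp add: cond_law_def)

lemma tv_dist_cond_law_le_d_TV:
  assumes "\<theta> \<in> space \<mu>" "\<theta>' \<in> space \<mu>" "\<omega>1 \<in> space \<mu>1"
  shows "tv_dist (cond_law \<mu>2 f2 \<theta> \<theta>' \<omega>1) (cond_law \<mu>2 f2 \<theta>' \<theta> \<omega>1) \<le> d_TV \<mu>1 \<mu>2 f2 \<theta> \<theta>'"
  unfolding d_TV_def using assms
  by (intro cSUP_upper bdd_aboveI2[where M = 1] tv_dist_le_1 prob_space_cond_law)

text \<open>Bounding the real supremum \<open>d_TV\<close> from above requires a nonempty index set;
  the probability law with density \<open>f1 \<theta>\<close> supplies a point.\<close>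

lemma space_\<mu>1_nonempty:
  assumes "\<theta> \<in> space \<mu>"
  shows "space \<mu>1 \<noteq> {}"
  using prob_space.not_empty[OF f1_prob[OF assms]] by simp

lemma p_aux_ge:
  assumes \<theta>: "\<theta> \<in> space \<mu>" and \<theta>': "\<theta>' \<in> space \<mu>"
  shows "ennreal (1 - d_TV \<mu>1 \<mu>2 f2 \<theta> \<theta>') * p_MwG \<mu>1 post f1 q \<theta> \<theta>'
    \<le> p_aux \<mu>1 \<mu>2 post f1 f2 q \<theta> \<theta>'"
proof -
  note [measurable] = f1_measurable1[OF \<theta>] f1_measurable1[OF \<theta>'] q_measurable1[OF \<theta> \<theta>']
    q_measurable1[OF \<theta>' \<theta>]
  let ?a = "\<lambda>\<omega>1. post \<theta> * f1 \<theta> \<omega>1 * q \<omega>1 \<theta> \<theta>'" and ?b = "\<lambda>\<omega>1. post \<theta>' * f1 \<theta>' \<omega>1 * q \<omega>1 \<theta>' \<theta>"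
  \<comment> \<open>\<open>w\<close> is the integrand of \<open>p_MwG\<close>, so the constant
    \<open>1 - d_TV\<close> moves under the outer integral and the claim reduces to a comparison at
    each fixed \<omega>1.\<close>
  define w where "w \<omega>1 = f1 \<theta> \<omega>1 * q \<omega>1 \<theta> \<theta>' * accept_prob (?b \<omega>1) (?a \<omega>1)" for \<omega>1
  have [measurable]: "w \<in> borel_measurable \<mu>1"
    unfolding w_def accept_prob_def by measurable
  have "ennreal (1 - d_TV \<mu>1 \<mu>2 f2 \<theta> \<theta>') * p_MwG \<mu>1 post f1 q \<theta> \<theta>'
      = (\<integral>\<^sup>+\<omega>1. ennreal (1 - d_TV \<mu>1 \<mu>2 f2 \<theta> \<theta>') * ennreal (w \<omega>1) \<partial>\<mu>1)"
    unfolding p_MwG_def w_def[symmetric] by (simp add: nn_integral_cmult)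
  also have "\<dots> \<le> p_aux \<mu>1 \<mu>2 post f1 f2 q \<theta> \<theta>'"
    unfolding p_aux_def
  proof (rule nn_integral_mono)
    fix \<omega>1 assume \<omega>1: "\<omega>1 \<in> space \<mu>1"
    let ?f = "f2 \<theta> \<theta>' \<omega>1" and ?g = "f2 \<theta>' \<theta> \<omega>1"
    note [measurable] = f2_measurable2[OF \<theta> \<theta>' \<omega>1] f2_measurable2[OF \<theta>' \<theta> \<omega>1]
    have nonneg: "0 \<le> post \<theta>" "0 \<le> post \<theta>'" "0 \<le> f1 \<theta> \<omega>1" "0 \<le> f1 \<theta>' \<omega>1"
      "0 \<le> q \<omega>1 \<theta> \<theta>'" "0 \<le> q \<omega>1 \<theta>' \<theta>"
      using \<theta> \<theta>' \<omega>1 by (auto intro: post_nonneg f1_nonneg q_nonneg)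
    then have w_nonneg: "0 \<le> w \<omega>1"
      by (auto simp: w_def accept_prob_def)
    have "ennreal (1 - d_TV \<mu>1 \<mu>2 f2 \<theta> \<theta>')
        \<le> ennreal (1 - tv_dist (cond_law \<mu>2 f2 \<theta> \<theta>' \<omega>1) (cond_law \<mu>2 f2 \<theta>' \<theta> \<omega>1))"
      using tv_dist_cond_law_le_d_TV[OF \<theta> \<theta>' \<omega>1] by (intro ennreal_leI) simp
    also have "\<dots> \<le> (\<integral>\<^sup>+\<omega>2. ennreal (min (?f \<omega>2) (?g \<omega>2)) \<partial>\<mu>2)"
      unfolding cond_law_def using \<theta> \<theta>' \<omega>1
      by (intro one_minus_tv_dist_le_overlap f2_prob) auto
    finally have "ennreal (1 - d_TV \<mu>1 \<mu>2 f2 \<theta> \<theta>') * ennreal (w \<omega>1)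
        \<le> (\<integral>\<^sup>+\<omega>2. ennreal (min (?f \<omega>2) (?g \<omega>2)) \<partial>\<mu>2) * ennreal (w \<omega>1)"
      by (rule mult_right_mono) simp
    also have "\<dots> = (\<integral>\<^sup>+\<omega>2. ennreal (w \<omega>1 * min (?f \<omega>2) (?g \<omega>2)) \<partial>\<mu>2)"
      using w_nonneg by (simp add: nn_integral_cmult ennreal_mult' mult.commute)
    also have "\<dots> \<le> (\<integral>\<^sup>+\<omega>2. ennreal (f1 \<theta> \<omega>1 * q \<omega>1 \<theta> \<theta>' * ?f \<omega>2 *
        accept_prob
          (post \<theta>' * joint_dens f1 f2 \<theta>' \<theta> \<omega>1 \<omega>2 * q \<omega>1 \<theta>' \<theta>)
          (post \<theta> * joint_dens f1 f2 \<theta> \<theta>' \<omega>1 \<omega>2 * q \<omega>1 \<theta> \<theta>')) \<partial>\<mu>2)"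
    proof (intro nn_integral_mono ennreal_leI)
      fix \<omega>2 assume \<omega>2: "\<omega>2 \<in> space \<mu>2"
      \<comment> \<open>The numerator and denominator of the auxiliary ratio are \<open>?b\<close>
        and \<open>?a\<close> multiplied by \<open>?g\<close> and \<open>?f\<close>. The remaining
        factor \<open>f1 * q\<close> is restored afterwards.\<close>
      have "min (?f \<omega>2) (?g \<omega>2) * accept_prob (?b \<omega>1) (?a \<omega>1)
          \<le> ?f \<omega>2 * accept_prob (?b \<omega>1 * ?g \<omega>2) (?a \<omega>1 * ?f \<omega>2)"
        using nonneg \<theta> \<theta>' \<omega>1 \<omega>2 by (intro accept_prob_scale_ge f2_nonneg) auto
      then have "f1 \<theta> \<omega>1 * q \<omega>1 \<theta> \<theta>' * (min (?f \<omega>2) (?g \<omega>2) * accept_prob (?b \<omega>1) (?a \<omega>1))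
          \<le> f1 \<theta> \<omega>1 * q \<omega>1 \<theta> \<theta>' * (?f \<omega>2 * accept_prob (?b \<omega>1 * ?g \<omega>2) (?a \<omega>1 * ?f \<omega>2))"
        using nonneg by (intro mult_left_mono) auto
      then show "w \<omega>1 * min (?f \<omega>2) (?g \<omega>2) \<le> f1 \<theta> \<omega>1 * q \<omega>1 \<theta> \<theta>' * ?f \<omega>2 *
          accept_prob
            (post \<theta>' * joint_dens f1 f2 \<theta>' \<theta> \<omega>1 \<omega>2 * q \<omega>1 \<theta>' \<theta>)
            (post \<theta> * joint_dens f1 f2 \<theta> \<theta>' \<omega>1 \<omega>2 * q \<omega>1 \<theta> \<theta>')"
        by (simp add: w_def joint_dens_def mult_ac)
    qed
    finally show "ennreal (1 - d_TV \<mu>1 \<mu>2 f2 \<theta> \<theta>') * ennreal (w \<omega>1) \<le> \<dots>" .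
  qed
  finally show ?thesis .
qed

text \<open>The constant \<open>c\<close> must serve every \<omega>1 at once. At each \<omega>1 at
  least one of the two directed divergences is at most \<open>t\<close>, and by symmetry of total
  variation either one suffices.\<close>

lemma one_minus_d_TV_ge:
  assumes \<theta>: "\<theta> \<in> space \<mu>" and \<theta>': "\<theta>' \<in> space \<mu>"
  shows "ennreal (exp (- (1 / exp 1))) *
      exp_neg (min (d_KL \<mu>1 \<mu>2 f2 \<theta> \<theta>')
        (min (d_KL_tilde \<mu>1 \<mu>2 f2 \<theta> \<theta>') (d_KL_tilde \<mu>1 \<mu>2 f2 \<theta>' \<theta>)))
    \<le> ennreal (1 - d_TV \<mu>1 \<mu>2 f2 \<theta> \<theta>')"
proof -
  let ?P = "cond_law \<mu>2 f2 \<theta> \<theta>'" and ?Q = "cond_law \<mu>2 f2 \<theta>' \<theta>"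
  define t where "t = min (d_KL \<mu>1 \<mu>2 f2 \<theta> \<theta>')
    (min (d_KL_tilde \<mu>1 \<mu>2 f2 \<theta> \<theta>') (d_KL_tilde \<mu>1 \<mu>2 f2 \<theta>' \<theta>))"
  define c where "c = ennreal (exp (- (1 / exp 1))) * exp_neg t"
  have c_le: "c \<le> ennreal (1 - tv_dist (?P \<omega>1) (?Q \<omega>1))" if \<omega>1: "\<omega>1 \<in> space \<mu>1" for \<omega>1
  proof -
    have "ereal (1 / 2) * (kl_div (?P \<omega>1) (?Q \<omega>1) + kl_div (?Q \<omega>1) (?P \<omega>1)) \<le> d_KL \<mu>1 \<mu>2 f2 \<theta> \<theta>'"
      unfolding d_KL_def using \<omega>1 by (intro ereal_mult_left_mono SUP_upper2[OF \<omega>1]) auto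
    then have "min (kl_div (?P \<omega>1) (?Q \<omega>1)) (kl_div (?Q \<omega>1) (?P \<omega>1)) \<le> d_KL \<mu>1 \<mu>2 f2 \<theta> \<theta>'"
      by (rule order_trans[OF ereal_half_mult_add_ge_min])
    moreover have "kl_div (?P \<omega>1) (?Q \<omega>1) \<le> d_KL_tilde \<mu>1 \<mu>2 f2 \<theta> \<theta>'"
      "kl_div (?Q \<omega>1) (?P \<omega>1) \<le> d_KL_tilde \<mu>1 \<mu>2 f2 \<theta>' \<theta>"
      unfolding d_KL_tilde_def using \<omega>1 by (auto intro: SUP_upper)
    \<comment> \<open>Whichever of the three terms attains \<open>t\<close>, a directed divergence
      lies below it. In the \<open>d_KL\<close> case the half-sum dominates the smaller one, and
      which one that is may vary with \<omega>1.\<close>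
    ultimately have "kl_div (?P \<omega>1) (?Q \<omega>1) \<le> t \<or> kl_div (?Q \<omega>1) (?P \<omega>1) \<le> t"
      unfolding t_def by (auto simp: min_le_iff_disj min_def split: if_splits)
    then show ?thesis
    proof
      assume "kl_div (?P \<omega>1) (?Q \<omega>1) \<le> t"
      then show ?thesis
        unfolding c_def using \<theta> \<theta>' \<omega>1
        by (intro exp_neg_kl_div_le_one_minus_tv_dist prob_space_cond_law) simp_all
    next
      assume "kl_div (?Q \<omega>1) (?P \<omega>1) \<le> t"
      then have "c \<le> ennreal (1 - tv_dist (?Q \<omega>1) (?P \<omega>1))"
        unfolding c_def using \<theta> \<theta>' \<omega>1
        by (intro exp_neg_kl_div_le_one_minus_tv_dist prob_space_cond_law) simp_all
      then show ?thesis
        by (subst tv_dist_commute) simp_all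
    qed
  qed
  \<comment> \<open>A single instance of \<open>c_le\<close> shows that \<open>c\<close> is finite,
    hence a real \<open>r\<close>, so the supremum can be bounded in the reals.\<close>
  obtain \<omega>0 where "\<omega>0 \<in> space \<mu>1"
    using space_\<mu>1_nonempty[OF \<theta>] by auto
  with c_le have "c < \<infinity>"
    by (metis ennreal_less_top infinity_ennreal_def order_le_less_trans)
  then obtain r where r: "c = ennreal r" "0 \<le> r"
    by (cases c) auto
  \<comment> \<open>\<open>ennreal\<close> truncates negative reals to 0, so the real inequality is
    read off from \<open>c_le\<close> together with \<open>tv_dist\<close> being at most 1.\<close>
  have "tv_dist (?P \<omega>1) (?Q \<omega>1) \<le> 1 - r" if \<omega>1: "\<omega>1 \<in> space \<mu>1" for \<omega>1
    using c_le[OF \<omega>1] tv_dist_le_1[OF prob_space_cond_law prob_space_cond_law, OF \<theta> \<theta>' \<omega>1 \<theta>' \<theta> \<omega>1]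
    by (simp add: r)
  then have "d_TV \<mu>1 \<mu>2 f2 \<theta> \<theta>' \<le> 1 - r"
    unfolding d_TV_def using space_\<mu>1_nonempty[OF \<theta>] by (intro cSUP_least)
  then have "c \<le> ennreal (1 - d_TV \<mu>1 \<mu>2 f2 \<theta> \<theta>')"
    unfolding r(1) by (intro ennreal_leI) simp
  then show ?thesis
    by (simp add: c_def t_def)
qed

end

theorem theorem1:
  fixes \<mu> :: "'t measure" and \<mu>1 :: "'a measure" and \<mu>2 :: "'b measure"
    and post :: "'t \<Rightarrow> real"
    and f1 :: "'t \<Rightarrow> 'a \<Rightarrow> real"
    and f2 :: "'t \<Rightarrow> 't \<Rightarrow> 'a \<Rightarrow> 'b \<Rightarrow> real"
    and q :: "'a \<Rightarrow> 't \<Rightarrow> 't \<Rightarrow> real"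
    and \<theta> \<theta>' :: 't
  assumes "aux_mcmc \<mu> \<mu>1 \<mu>2 post f1 f2 q"
    and "\<theta> \<in> space \<mu>" and "\<theta>' \<in> space \<mu>" and "\<theta> \<noteq> \<theta>'"
  shows "p_aux \<mu>1 \<mu>2 post f1 f2 q \<theta> \<theta>'
           \<ge> ennreal (1 - d_TV \<mu>1 \<mu>2 f2 \<theta> \<theta>') * p_MwG \<mu>1 post f1 q \<theta> \<theta>'
       \<and> ennreal (1 - d_TV \<mu>1 \<mu>2 f2 \<theta> \<theta>') * p_MwG \<mu>1 post f1 q \<theta> \<theta>'
           \<ge> ennreal (exp (- (1 / exp 1))) *
             exp_neg (min (d_KL \<mu>1 \<mu>2 f2 \<theta> \<theta>')
               (min (d_KL_tilde \<mu>1 \<mu>2 f2 \<theta> \<theta>') (d_KL_tilde \<mu>1 \<mu>2 f2 \<theta>' \<theta>))) *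
             p_MwG \<mu>1 post f1 q \<theta> \<theta>'"
proof -
  interpret aux_mcmc \<mu> \<mu>1 \<mu>2 post f1 f2 q
    by (rule assms(1))
  show ?thesis
    \<comment> \<open>Multiplication by \<open>p_MwG\<close> is monotone in [0, \<infinity>], which
      also covers an infinite density.\<close>
    using p_aux_ge one_minus_d_TV_ge assms(2,3) by (auto intro: mult_right_mono)
qed

end
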